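(* For all integers $k\ge 1$ and $n\ge 1$, $$a_k(n)\ =\ a_{k-1}(n+2) - \binom{n+k}{k-1},$$ equivalently, $$\sum_{m=1}^n a_{k-1}(m) \ =\ a_{k-1}(n+2) - \binom{n+k}{k-1}.$$
   Context: Let $(F_n)_{n\ge 1}$ be the Fibonacci sequence with $F_1=F_2=1$ and $F_{n+2}=F_{n+1}+F_n$ for $n\ge 1$. Define $a_0(n)=F_n$ for $n\ge 1$, and for $k\ge 1$ define $a_k(n)=\sum_{i=1}^n a_{k-1}(i)$ for $n\ge 1$. Thus $(a_k(n))_{n\ge1}$ is the sequence obtained by applying the partial-sum operator $k$ times to the Fibonacci sequence. *)

theory Defs
  imports "HOL-Number_Theory.Fib"
begin

text \<open>
  The sequences are indexed from 1; the value at 0 is a junk value (it is 0 at every level,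
  and no sum ranges over it).
\<close>

primrec fib_psum :: "nat \<Rightarrow> nat \<Rightarrow> nat" where
  "fib_psum 0 = (\<lambda>n. fib n)"
| "fib_psum (Suc k) = (\<lambda>n. \<Sum>i=1..n. fib_psum k i)"

end

theory Submission
  imports Defs
begin

text \<open>Passing from \<open>n\<close> to \<open>n + 1\<close>, the identity at level
  \<open>k + 1\<close> changes by exactly the identity at level \<open>k\<close>, because Pascal's
  rule matches the recurrence of partial sums. Induction on the level, then on \<open>n\<close>,
  starts from F_1 + ... + F_n = F_(n+2) - 1; \<open>fib_psum_Suc_plus_binomial\<close> carries it
  out.\<close>

lemma fib_psum_Suc_Suc: "fib_psum (Suc k) (Suc n) = fib_psum (Suc k) n + fib_psum k (Suc n)"
  by simp

lemma fib_psum_one: "fib_psum k (Suc 0) = 1"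
  by (induction k) auto

lemma fib_psum_two: "fib_psum k (Suc (Suc 0)) = Suc k"
proof (induction k)
  case (Suc k)
  then show ?case
    by (simp only: fib_psum_Suc_Suc[of k "Suc 0"] fib_psum_one)
qed simp

text \<open>The additive form avoids truncated subtraction on \<open>nat\<close>. Admitting
  \<open>n = 0\<close>, where the left-hand sum is empty, gives the inner induction an easy
  start.\<close>

lemma fib_psum_Suc_plus_binomial:
  "fib_psum (Suc k) n + (Suc (n + k) choose k) = fib_psum k (Suc (Suc n))"
proof (induction k arbitrary: n)
  case 0
  show ?case
    by (induction n) auto
next
  case (Suc k)
  show ?case
  proof (induction n)
    case 0
    show ?case
      \<comment> \<open>Both sides equal \<open>k + 2\<close>: symmetry turns the binomial into
        \<open>Suc (Suc k) choose 1\<close>.\<close>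
      using binomial_symmetric[of "Suc k" "Suc (Suc k)"]
      by (simp add: fib_psum_two del: fib_psum.simps(2)) simp
  next
    case (Suc n)
    have "Suc (Suc n + Suc k) choose Suc k
        = (Suc (n + Suc k) choose Suc k) + (Suc (Suc n + k) choose k)"
      by simp
    \<comment> \<open>The first Pascal summand goes with the inner hypothesis at \<open>n\<close>,
      the second with the outer one at \<open>Suc n\<close>; adding the two gives the claim.\<close>
    then show ?case
      using Suc \<open>\<And>n. fib_psum (Suc k) n + (Suc (n + k) choose k) = fib_psum k (Suc (Suc n))\<close>[of "Suc n"]
      unfolding fib_psum_Suc_Suc[of "Suc k" n] fib_psum_Suc_Suc[of k "Suc (Suc n)"]
      by linarith
  qed
qed

theorem theorem1p1:
  fixes k n :: nat
  assumes "k \<ge> 1" and "n \<ge> 1"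
  shows "int (fib_psum k n) = int (fib_psum (k - 1) (n + 2)) - int ((n + k) choose (k - 1))
       \<and> (\<Sum>m=1..n. int (fib_psum (k - 1) m))
           = int (fib_psum (k - 1) (n + 2)) - int ((n + k) choose (k - 1))"
proof -
  obtain j where k: "k = Suc j"
    using assms(1) by (cases k) auto
  have "int (fib_psum k n) = int (fib_psum (k - 1) (n + 2)) - int ((n + k) choose (k - 1))"
    using fib_psum_Suc_plus_binomial[of j n, symmetric] by (simp add: k)
  moreover have "(\<Sum>m=1..n. int (fib_psum (k - 1) m)) = int (fib_psum k n)"
    by (simp add: k)
  ultimately show ?thesis
    by simp
qed

end
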